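(* Let $P$ be a complex polynomial of degree $n\ge 1$ all of whose zeros lie in the closed disc $|z|\le 1$. Suppose that for some point $z_0$ on the circle $|z|=1$ and some $\alpha$ with $0<\alpha<\pi$ the arc $$\gamma(z_0,\alpha):=\{z:\ |z|=1,\ |\arg z-\arg z_0|<\alpha\}$$ does not contain zeros of $P$, and that, for some $\beta$ with $0<\beta<\pi$, the increment of the quantity $$2\arg P(z)-n\arg z$$ along any curve on the arc $\gamma(z_0,\alpha)$ with an end point at $z_0$ does not exceed $\beta$ in absolute value. Then $$\Lambda(P,z_0)\ \le\ \frac{\tan\frac{\beta}{2}}{\tan\frac{\alpha}{2}}.$$ Equality is attained for a polynomial $P$ of the form $$P(z)=c_n z(z-\alpha_2)\cdots(z-\alpha_n),\qquad c_n\neq 0,\quad |\alpha_k|=1,\ \alpha_k\neq 1,\ k=2,\dots,n,$$ the point $z_0=1$, any $\alpha$, $0<\alpha<\pi$, for which the arc $\gamma(1,\alpha)$ does not contain $\alpha_k$, $k=2,\dots,n$, and $\beta=\alpha$.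
   Context: For a polynomial $P$ of degree $n$ and a point $z=e^{i\theta}$ ($\theta$ real) with $P(z)\neq 0$, define $$\Lambda(P,z)=2\,(\arg P(e^{i\theta}))'_{\theta}-n,$$ where $(\arg P(e^{i\theta}))'_\theta$ is the derivative with respect to $\theta$ of a local continuous branch of the argument of $P(e^{i\theta})$; equivalently $(\arg P(e^{i\theta}))'_\theta=\operatorname{Re}\frac{zP'(z)}{P(z)}$ at $z=e^{i\theta}$, so $\Lambda(P,z)=2\operatorname{Re}\frac{zP'(z)}{P(z)}-n$. The arc $\gamma(z_0,\alpha)$ is the open arc of the unit circle centred at $z_0$ of angular half-width $\alpha$, i.e. $\gamma(z_0,\alpha)=\{z_0e^{it}:\ |t|<\alpha\}$. The increment of $2\arg P(z)-n\arg z$ along a curve on this arc is the total change along the curve of this quantity, computed with continuous branches of $\arg P(z)$ and $\arg z$ along the curve. *)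

theory Defs
  imports "HOL-Analysis.Analysis" "HOL-Computational_Algebra.Polynomial"
begin

definition arg_branch :: "(real \<Rightarrow> complex) \<Rightarrow> real set \<Rightarrow> (real \<Rightarrow> real) \<Rightarrow> bool" where
  "arg_branch f S \<phi> \<longleftrightarrow>
     continuous_on S \<phi> \<and> (\<forall>t\<in>S. f t \<noteq> 0 \<and> f t = rcis (cmod (f t)) (\<phi> t))"

text \<open>The derivative at \<open>\<theta>\<close> of a continuous branch of \<open>arg (f t)\<close> near \<open>\<theta>\<close>. It does not depend
  on the branch; where no differentiable branch exists (for instance if \<open>f \<theta> = 0\<close>) the value is
  unspecified.\<close>

definition arg_deriv :: "(real \<Rightarrow> complex) \<Rightarrow> real \<Rightarrow> real" where
  "arg_deriv f \<theta> = (THE d. \<exists>U \<phi>. open U \<and> \<theta> \<in> U \<and> arg_branch f U \<phi> \<and>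
                        (\<phi> has_real_derivative d) (at \<theta>))"

text \<open>Meaningful for \<open>cmod z = 1\<close> and \<open>poly P z \<noteq> 0\<close>; then \<open>z = cis (Arg z)\<close>, and any other
  \<open>\<theta>\<close> with \<open>z = cis \<theta>\<close> would give the same value.\<close>

definition Lambda :: "complex poly \<Rightarrow> complex \<Rightarrow> real" where
  "Lambda P z = 2 * arg_deriv (\<lambda>t. poly P (cis t)) (Arg z) - real (degree P)"

definition circle_arc :: "complex \<Rightarrow> real \<Rightarrow> complex set" where
  "circle_arc z0 \<alpha> = {z0 * cis t | t. \<bar>t\<bar> < \<alpha>}"

text \<open>The total change of \<open>arg (f t)\<close> over \<open>{0..1}\<close>, for continuous nowhere vanishing \<open>f\<close>.\<close>

definition arg_increment :: "(real \<Rightarrow> complex) \<Rightarrow> real" where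
  "arg_increment f = (THE d. \<exists>\<phi>. arg_branch f {0..1} \<phi> \<and> d = \<phi> 1 - \<phi> 0)"

definition curve_increment :: "complex poly \<Rightarrow> (real \<Rightarrow> complex) \<Rightarrow> real" where
  "curve_increment P g = 2 * arg_increment (poly P \<circ> g) - real (degree P) * arg_increment g"

definition increment_bounded :: "complex poly \<Rightarrow> complex \<Rightarrow> real \<Rightarrow> real \<Rightarrow> bool" where
  "increment_bounded P z0 \<alpha> \<beta> \<longleftrightarrow>
     (\<forall>g. path g \<and> path_image g \<subseteq> circle_arc z0 \<alpha> \<and> (pathstart g = z0 \<or> pathfinish g = z0) \<longrightarrow>
          \<bar>curve_increment P g\<bar> \<le> \<beta>)"


lemma cis_has_vector_derivative: "(cis has_vector_derivative (\<i> * cis x)) (at x)"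
proof -
  have "((\<lambda>z. exp (\<i> * z)) has_field_derivative \<i> * exp (\<i> * of_real x)) (at (of_real x))"
    by (auto intro!: derivative_eq_intros)
  from has_vector_derivative_real_field[OF this] show ?thesis
    by (simp add: cis_conv_exp[abs_def])
qed

lemma arg_branch_deriv_unique:
  assumes U: "open U" "\<theta> \<in> U" and br: "arg_branch f U \<phi>"
    and d: "(\<phi> has_real_derivative d) (at \<theta>)"
    and f: "(f has_vector_derivative f') (at \<theta>)"
  shows "d = Im (f' / f \<theta>)"
proof -
  define h where "h = (\<lambda>t. f t * cis (- \<phi> t))"
  have f0: "f \<theta> \<noteq> 0" and f\<theta>: "f \<theta> = complex_of_real (cmod (f \<theta>)) * cis (\<phi> \<theta>)"
    using br U by (auto simp: arg_branch_def rcis_def)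
  have hU: "Im (h t) = 0" if "t \<in> U" for t
  proof -
    have "f t = complex_of_real (cmod (f t)) * cis (\<phi> t)"
      using br that by (auto simp: arg_branch_def rcis_def)
    then have "h t = complex_of_real (cmod (f t)) * (cis (\<phi> t) * cis (- \<phi> t))"
      unfolding h_def by (metis mult.assoc)
    then show ?thesis by (simp add: cis_mult)
  qed
  have c: "((\<lambda>t. cis (- \<phi> t)) has_vector_derivative (- d) *\<^sub>R (\<i> * cis (- \<phi> \<theta>))) (at \<theta>)"
  proof -
    have "((\<lambda>t. - \<phi> t) has_vector_derivative (- d)) (at \<theta>)"
      using d has_real_derivative_iff_has_vector_derivative
      by (auto intro!: derivative_eq_intros)
    moreover have "(cis has_vector_derivative (\<i> * cis (- \<phi> \<theta>))) (at (- \<phi> \<theta>))"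
      by (rule cis_has_vector_derivative)
    ultimately show ?thesis
      using vector_diff_chain_at[of "\<lambda>t. - \<phi> t" "- d" \<theta> cis] by (simp add: o_def)
  qed
  have hd: "(h has_vector_derivative
      (f \<theta> * ((- d) *\<^sub>R (\<i> * cis (- \<phi> \<theta>))) + f' * cis (- \<phi> \<theta>))) (at \<theta>)"
    unfolding h_def by (rule has_vector_derivative_mult[OF f c])
  have "((\<lambda>t. Im (h t)) has_vector_derivative
      Im (f \<theta> * ((- d) *\<^sub>R (\<i> * cis (- \<phi> \<theta>))) + f' * cis (- \<phi> \<theta>))) (at \<theta>)"
    by (rule bounded_linear.has_vector_derivative[OF bounded_linear_Im hd])
  moreover have "((\<lambda>t. Im (h t)) has_vector_derivative 0) (at \<theta>)"
  proof (rule has_vector_derivative_transform_within_open[OF _ U])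
    show "((\<lambda>_. 0::real) has_vector_derivative 0) (at \<theta>)" by simp
    show "0 = Im (h t)" if "t \<in> U" for t using hU[OF that] by simp
  qed
  ultimately have z: "Im (f \<theta> * ((- d) *\<^sub>R (\<i> * cis (- \<phi> \<theta>))) + f' * cis (- \<phi> \<theta>)) = 0"
    by (rule vector_derivative_unique_at)
  have r: "f \<theta> * cis (- \<phi> \<theta>) = complex_of_real (cmod (f \<theta>))"
    by (subst f\<theta>) (simp add: mult.assoc cis_mult)
  have "f \<theta> * ((- d) *\<^sub>R (\<i> * cis (- \<phi> \<theta>))) + f' * cis (- \<phi> \<theta>)
      = (f' / f \<theta> - \<i> * of_real d) * (f \<theta> * cis (- \<phi> \<theta>))"
    using f0 by (simp add: scaleR_conv_of_real field_simps)
  also have "\<dots> = (f' / f \<theta> - \<i> * of_real d) * complex_of_real (cmod (f \<theta>))"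
    by (simp only: r)
  finally have "Im ((f' / f \<theta> - \<i> * of_real d) * complex_of_real (cmod (f \<theta>))) = 0"
    using z by simp
  then have "(Im (f' / f \<theta>) - d) * cmod (f \<theta>) = 0"
    by (simp del: Im_divide_of_real)
  then show ?thesis using f0 by simp
qed

lemma arg_deriv_eq:
  assumes cont: "continuous_on UNIV f" and f: "(f has_vector_derivative f') (at \<theta>)"
    and f0: "f \<theta> \<noteq> 0"
  shows "arg_deriv f \<theta> = Im (f' / f \<theta>)"
proof -
  define U where "U = (\<lambda>t. f t / f \<theta>) -` (- \<real>\<^sub>\<le>\<^sub>0)"
  define \<phi> where "\<phi> = (\<lambda>t. Im (Ln (f t / f \<theta>)) + Arg (f \<theta>))"
  have U: "open U" "\<theta> \<in> U"
  proof -
    show "open U" unfolding U_def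
      by (rule open_vimage) (auto intro!: continuous_intros cont simp: f0 closed_nonpos_Reals_complex)
    show "\<theta> \<in> U" using f0 by (simp add: U_def)
  qed
  have nz: "f t \<noteq> 0" if "t \<in> U" for t using that by (auto simp: U_def)
  have br: "arg_branch f U \<phi>"
    unfolding arg_branch_def
  proof (intro conjI ballI)
    show "continuous_on U \<phi>" unfolding \<phi>_def
      by (intro continuous_intros continuous_on_subset[OF cont]) (auto simp: f0 U_def)
    fix t assume t: "t \<in> U"
    show "f t \<noteq> 0" using nz[OF t] .
    have "cis (\<phi> t) = sgn (f t)"
      using nz[OF t] f0
      by (simp add: \<phi>_def cis_mult[symmetric] Arg_eq_Im_Ln[symmetric] cis_Arg sgn_divide sgn_zero_iff)
    then show "f t = rcis (cmod (f t)) (\<phi> t)"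
      using nz[OF t] by (simp add: rcis_def sgn_eq)
  qed
  have "(\<phi> has_real_derivative Im (f' / f \<theta>)) (at \<theta>)"
  proof -
    have "((\<lambda>t. f t / f \<theta>) has_vector_derivative f' / f \<theta>) (at \<theta>)"
      by (rule bounded_linear.has_vector_derivative[OF bounded_linear_divide f])
    moreover have "(Ln has_field_derivative 1) (at (f \<theta> / f \<theta>))"
      using f0 by (auto intro!: derivative_eq_intros)
    ultimately have "((Ln \<circ> (\<lambda>t. f t / f \<theta>)) has_vector_derivative f' / f \<theta> * 1) (at \<theta>)"
      by (rule field_vector_diff_chain_at)
    then have "((\<lambda>t. Im (Ln (f t / f \<theta>))) has_vector_derivative Im (f' / f \<theta>)) (at \<theta>)"
      using bounded_linear.has_vector_derivative[OF bounded_linear_Im] by (fastforce simp: o_def)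
    then show ?thesis
      unfolding \<phi>_def has_real_derivative_iff_has_vector_derivative
      by (auto intro!: derivative_eq_intros)
  qed
  with U br show ?thesis
    unfolding arg_deriv_def
    by (intro the_equality) (blast, metis arg_branch_deriv_unique f)
qed

lemma Lambda_eq:
  assumes "cmod z = 1" "poly P z \<noteq> 0"
  shows "Lambda P z = 2 * Re (z * poly (pderiv P) z / poly P z) - real (degree P)"
proof -
  have z: "cis (Arg z) = z"
    using assms by (metis cis_Arg norm_zero sgn_eq div_by_1 of_real_1 zero_neq_one)
  have "(cis has_vector_derivative (\<i> * cis (Arg z))) (at (Arg z))"
    by (rule cis_has_vector_derivative)
  from field_vector_diff_chain_at[OF this poly_DERIV, of P]
  have "((\<lambda>t. poly P (cis t)) has_vector_derivative \<i> * z * poly (pderiv P) z) (at (Arg z))"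
    by (simp add: z o_def)
  from arg_deriv_eq[OF _ this] assms(2)
  have "arg_deriv (\<lambda>t. poly P (cis t)) (Arg z) = Im (\<i> * (z * poly (pderiv P) z / poly P z))"
    by (simp add: z continuous_intros mult.assoc del: Im_i_times)
  then have "arg_deriv (\<lambda>t. poly P (cis t)) (Arg z) = Re (z * poly (pderiv P) z / poly P z)"
    by (simp only: Im_i_times)
  then show ?thesis by (simp add: Lambda_def)
qed

lemma arg_increment_eq:
  assumes "arg_branch f {0..1} \<phi>"
  shows "arg_increment f = \<phi> 1 - \<phi> 0"
  unfolding arg_increment_def
proof (rule the_equality)
  show "\<exists>\<psi>. arg_branch f {0..1} \<psi> \<and> \<phi> 1 - \<phi> 0 = \<psi> 1 - \<psi> 0" using assms by blast
  fix d assume "\<exists>\<psi>. arg_branch f {0..1} \<psi> \<and> d = \<psi> 1 - \<psi> 0"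
  then obtain \<psi> where \<psi>: "arg_branch f {0..1} \<psi>" and d: "d = \<psi> 1 - \<psi> 0" by blast
  have "cis (\<psi> t - \<phi> t) = 1" if "t \<in> {0..1}" for t
  proof -
    have "rcis (cmod (f t)) (\<psi> t) = rcis (cmod (f t)) (\<phi> t)" "f t \<noteq> 0"
      using assms \<psi> that unfolding arg_branch_def by metis+
    then show ?thesis by (simp add: rcis_def cis_divide[symmetric])
  qed
  note one = this
  have I: "\<exists>k::int. \<psi> t - \<phi> t = of_int (2 * k) * pi" if "t \<in> {0..1}" for t
  proof -
    have "cos (\<psi> t - \<phi> t) = 1"
      using one[OF that] by (simp add: complex_eq_iff)
    then obtain k :: int where "\<psi> t - \<phi> t = of_int k * 2 * pi"
      using cos_one_2pi_int by blast
    then show ?thesis by (intro exI[of _ k]) simp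
  qed
  have "(\<lambda>t. \<psi> t - \<phi> t) constant_on {0..1}"
  proof (rule continuous_discrete_range_constant)
    show "continuous_on {0..1} (\<lambda>t. \<psi> t - \<phi> t)"
      using assms \<psi> by (auto simp: arg_branch_def intro!: continuous_intros)
    fix x :: real assume x: "x \<in> {0..1}"
    have "2 * pi \<le> norm ((\<psi> y - \<phi> y) - (\<psi> x - \<phi> x))"
      if y: "y \<in> {0..1}" "\<psi> y - \<phi> y \<noteq> \<psi> x - \<phi> x" for y
    proof -
      obtain j k :: int where jk: "\<psi> x - \<phi> x = of_int (2 * j) * pi" "\<psi> y - \<phi> y = of_int (2 * k) * pi"
        using I x y(1) by blast
      then have "k - j \<noteq> 0" using y(2) by auto
      then have "1 \<le> \<bar>k - j\<bar>" by linarith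
      then have "1 \<le> \<bar>real_of_int (k - j)\<bar>" by linarith
      moreover have "norm ((\<psi> y - \<phi> y) - (\<psi> x - \<phi> x)) = 2 * pi * \<bar>real_of_int (k - j)\<bar>"
      proof -
        have "(\<psi> y - \<phi> y) - (\<psi> x - \<phi> x) = 2 * pi * real_of_int (k - j)"
          unfolding jk by (simp add: algebra_simps)
        then show ?thesis by (simp only: real_norm_def abs_mult) simp
      qed
      ultimately show ?thesis using mult_left_mono[of 1 "\<bar>real_of_int (k - j)\<bar>" "2 * pi"] by simp
    qed
    then show "\<exists>e>0. \<forall>y. y \<in> {0..1} \<and> \<psi> y - \<phi> y \<noteq> \<psi> x - \<phi> x \<longrightarrow>
        e \<le> norm ((\<psi> y - \<phi> y) - (\<psi> x - \<phi> x))"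
      by (intro exI[of _ "2 * pi"]) auto
  qed simp
  then have "\<psi> 1 - \<phi> 1 = \<psi> 0 - \<phi> 0" unfolding constant_on_def by (metis atLeastAtMost_iff order_refl zero_le_one)
  then show "d = \<phi> 1 - \<phi> 0" using d by simp
qed

lemma arg_branch_exists:
  assumes "path g" "0 \<notin> path_image g"
  shows "\<exists>\<phi>. arg_branch g {0..1} \<phi>"
proof -
  have "continuous_on {0..1} g" "\<And>t. t \<in> {0..1} \<Longrightarrow> g t \<noteq> 0"
    using assms by (auto simp: path_def path_image_def)
  moreover have "contractible {0..1::real}" by (simp add: convex_imp_contractible)
  ultimately obtain l where l: "continuous_on {0..1} l" "\<And>t. t \<in> {0..1} \<Longrightarrow> g t = exp (l t)"
    using continuous_logarithm_on_contractible by metis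
  have "arg_branch g {0..1} (\<lambda>t. Im (l t))"
    unfolding arg_branch_def
  proof (intro conjI ballI)
    show "continuous_on {0..1} (\<lambda>t. Im (l t))" by (rule continuous_on_Im[OF l(1)])
    fix t :: real assume t: "t \<in> {0..1}"
    show "g t \<noteq> 0" using l(2)[OF t] by simp
    show "g t = rcis (cmod (g t)) (Im (l t))"
      unfolding l(2)[OF t] by (simp add: rcis_def flip: exp_eq_polar)
  qed
  then show ?thesis by blast
qed

end

theory Submission
  imports Defs "HOL-Computational_Algebra.Fundamental_Theorem_Algebra" "HOL-Real_Asymp.Real_Asymp"
begin

text \<open>
  On the unit circle a polynomial \<open>P\<close> of degree \<open>n\<close> with zeros \<open>a\<close> in the closed disc satisfies,
  up to a constant, \<open>2 arg P - n arg z = arg B\<close>, where \<open>B\<close> is the product of the Blaschke factors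
  \<open>(z - a) / (1 - cnj a * z)\<close>; zeros on the circle give constant factors. Writing \<open>\<phi>\<close> for this
  quantity along \<open>z = z0 * cis t\<close>, normalised by \<open>\<phi> 0 = 0\<close>, the value \<open>\<Lambda>(P, z0)\<close> is the initial
  rate \<open>\<lambda> = \<phi>' 0\<close>, and \<open>\<phi>'\<close> is a sum of Poisson kernels.

  The inequality is a boundary Schwarz lemma. Its source is the two-point inequality
  \<open>(sin (\<phi> t / 2))\<^sup>2 \<le> \<lambda> * \<phi>' t * (sin (t / 2))\<^sup>2\<close>, the boundary form of
  the positivity of the kernel \<open>(1 - B z * cnj (B w)) / (1 - z * cnj w)\<close>.
  It is an equality for a single Blaschke factor, and passes to products by subadditivity of
  \<open>\<bar>sin\<bar>\<close> and the Cauchy-Schwarz inequality (lemma \<open>sin_sum_phase_diff_le\<close>).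

  If \<open>\<lambda> > 0\<close>, the two-point inequality says precisely that
  \<open>G t = cot (\<phi> t / 2) - cot (t / 2) / \<lambda>\<close> has derivative \<open>\<le> 0\<close>. The two poles at \<open>t = 0\<close> cancel,
  so \<open>G\<close> has a finite two-sided limit there, whence \<open>G t \<le> G (- t)\<close> for \<open>0 < t < \<alpha>\<close>. Since
  \<open>\<phi>\<close> stays in \<open>{-\<beta>..\<beta>}\<close> and is increasing, this gives \<open>cot (\<beta> / 2) \<le> cot (t / 2) / \<lambda>\<close>, and
  \<open>t \<longlongrightarrow> \<alpha>\<close> finishes the proof (lemma \<open>initial_rate_le\<close>).

  For the extremal polynomial only the zero at the origin contributes: \<open>\<phi> t = t\<close>, so the
  increments are changes of angle within the arc and \<open>\<Lambda> = 1\<close>.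
\<close>

section \<open>The argument of a Blaschke factor on the circle\<close>

text \<open>For \<open>cmod a \<le> 1\<close> this is a branch of \<open>2 arg (cis t - a) - t\<close>: write
  \<open>cis t - a = cis t * (1 - a * cis (- t))\<close>, where the second factor stays in the open right
  half-plane as long as \<open>cis t \<noteq> a\<close>, so that the principal logarithm is a
  continuous branch of its argument.\<close>
definition phase :: "complex \<Rightarrow> real \<Rightarrow> real" where
  "phase a t = t + 2 * Im (Ln (1 - a * cis (- t)))"

text \<open>The Poisson kernel of the disc at the point \<open>a\<close>, for the boundary point \<open>cis t\<close>.\<close>
definition poisson :: "complex \<Rightarrow> real \<Rightarrow> real" where
  "poisson a t = (1 - (cmod a)\<^sup>2) / (cmod (cis t - a))\<^sup>2"

lemma cis_diff_eq: "cis t - a = cis t * (1 - a * cis (- t))"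
  by (simp add: algebra_simps cis_mult)

text \<open>A point of the closed unit disc with real part at least 1 can only be 1 itself.\<close>
lemma Re_one_minus_rotation_pos:
  assumes "cmod a \<le> 1" "cis t \<noteq> a"
  shows "Re (1 - a * cis (- t)) > 0"
proof (rule ccontr)
  define w where "w = a * cis (- t)"
  assume "\<not> ?thesis"
  then have "Re w \<ge> 1" by (simp add: w_def)
  moreover have "cmod w \<le> 1" using assms by (simp add: w_def norm_mult)
  ultimately have "Re w = 1" "cmod w = 1" using complex_Re_le_cmod[of w] by auto
  then have "w = 1" by (auto simp: cmod_def complex_eq_iff)
  then have "a = cis t" by (simp add: w_def mult.commute[of a] flip: cis_inverse) (simp add: field_simps)
  with assms show False by simp
qed

lemma cmod_cis_diff_eq: "cmod (cis t - a) = cmod (1 - a * cis (- t))"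
  by (subst cis_diff_eq) (simp add: norm_mult)

text \<open>With \<open>w = a * cis (- t)\<close> the logarithmic derivative of \<open>1 - w\<close> gives
  \<open>phase' = Re ((1 + w) / (1 - w))\<close>, which is the Poisson kernel.\<close>
lemma phase_has_derivative:
  assumes "cmod a \<le> 1" "cis t \<noteq> a"
  shows "(phase a has_real_derivative poisson a t) (at t)"
proof -
  define w where "w = a * cis (- t)"
  have pos: "Re (1 - w) > 0" using Re_one_minus_rotation_pos[OF assms] by (simp add: w_def)
  have nz: "1 - w \<notin> \<real>\<^sub>\<le>\<^sub>0" using pos by (auto simp: complex_nonpos_Reals_iff)
  have "(cis has_vector_derivative \<i> * cis (- t)) (at (- t))"
    by (rule cis_has_vector_derivative)
  moreover have "((\<lambda>t. - t) has_vector_derivative (- 1)) (at t)"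
    by (auto intro!: derivative_eq_intros)
  ultimately have "((\<lambda>t. cis (- t)) has_vector_derivative (- 1) *\<^sub>R (\<i> * cis (- t))) (at t)"
    using vector_diff_chain_at[of "\<lambda>t. - t" "- 1" t cis] by (simp add: o_def)
  then have "((\<lambda>t. 1 - a * cis (- t)) has_vector_derivative \<i> * w) (at t)"
    by (auto intro!: derivative_eq_intros simp: w_def)
  moreover have "(Ln has_field_derivative inverse (1 - w)) (at (1 - a * cis (- t)))"
    using has_field_derivative_Ln[OF nz] by (simp add: w_def)
  ultimately have "((Ln \<circ> (\<lambda>t. 1 - a * cis (- t))) has_vector_derivative \<i> * w * inverse (1 - w)) (at t)"
    by (rule field_vector_diff_chain_at)
  then have "((\<lambda>t. Im (Ln (1 - a * cis (- t)))) has_real_derivative Im (\<i> * w * inverse (1 - w))) (at t)"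
    using bounded_linear.has_vector_derivative[OF bounded_linear_Im]
    by (fastforce simp: o_def has_real_derivative_iff_has_vector_derivative)
  then have "(phase a has_real_derivative 1 + 2 * Im (\<i> * w * inverse (1 - w))) (at t)"
    unfolding phase_def by (intro DERIV_add DERIV_ident DERIV_cmult)
  moreover have "1 + 2 * Im (\<i> * w * inverse (1 - w)) = poisson a t"
  proof -
    have w: "(cmod a)\<^sup>2 = (cmod w)\<^sup>2" by (simp add: w_def norm_mult)
    define D where "D = (1 - Re w)\<^sup>2 + (Im w)\<^sup>2"
    have "D > 0" using pos by (simp add: D_def sum_power2_gt_zero_iff)
    have "Im (\<i> * w * inverse (1 - w)) = (Re w * (1 - Re w) - (Im w)\<^sup>2) / D"
      by (simp add: D_def right_diff_distrib diff_divide_distrib power2_eq_square)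
    then have "1 + 2 * Im (\<i> * w * inverse (1 - w)) = (D + 2 * (Re w * (1 - Re w) - (Im w)\<^sup>2)) / D"
      using \<open>D > 0\<close> by (simp add: field_simps)
    also have "D + 2 * (Re w * (1 - Re w) - (Im w)\<^sup>2) = 1 - (cmod w)\<^sup>2"
      unfolding D_def cmod_power2 by (simp add: power2_eq_square algebra_simps)
    also have "D = (cmod (1 - w))\<^sup>2" by (simp add: D_def cmod_power2)
    finally show ?thesis
      by (simp add: poisson_def cmod_cis_diff_eq w flip: w_def)
  qed
  ultimately show ?thesis by simp
qed

lemma cis_Im_Ln: "cis (Im (Ln w)) = w / of_real (cmod w)" if "w \<noteq> 0"
  using that by (simp add: cis_Arg sgn_eq flip: Arg_eq_Im_Ln)

text \<open>The phase is an argument of the Blaschke factor with zero \<open>a\<close>, because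
  \<open>cis (2 * Im (Ln w)) = w / cnj w\<close>. The factor may have its zero on the circle, in which case it
  is constant.\<close>
lemma cis_phase:
  assumes "cmod a \<le> 1" "cis t \<noteq> a"
  shows "cis (phase a t) = (cis t - a) / (1 - cnj a * cis t)"
proof -
  define w where "w = 1 - a * cis (- t)"
  have "Re w > 0" using Re_one_minus_rotation_pos[OF assms] by (simp add: w_def)
  then have w0: "w \<noteq> 0" by auto
  have cw: "1 - cnj a * cis t = cnj w" by (simp add: w_def cis_cnj)
  have "cis (phase a t) = cis t * (cis (Im (Ln w)))\<^sup>2"
    by (simp add: phase_def w_def Complex.DeMoivre flip: cis_mult)
  also have "\<dots> = cis t * w\<^sup>2 / (w * cnj w)"
    using w0 by (simp add: cis_Im_Ln power_divide flip: of_real_power complex_norm_square)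
  also have "\<dots> = cis t * w / cnj w" using w0 by (simp add: power2_eq_square)
  also have "cis t * w = cis t - a" using cis_diff_eq[of t a] by (simp add: w_def)
  finally show ?thesis by (simp add: cw)
qed

lemma chord_length: "cmod (cis x - cis y) = 2 * \<bar>sin ((x - y) / 2)\<bar>"
proof -
  have "(cmod (cis x - cis y))\<^sup>2 = (2 * \<bar>sin ((x - y) / 2)\<bar>)\<^sup>2"
  proof -
    have "(cmod (cis x - cis y))\<^sup>2 = 2 - 2 * cos (x - y)"
      using sin_cos_squared_add[of x] sin_cos_squared_add[of y]
      unfolding cmod_power2 by (simp add: cos_diff power2_eq_square algebra_simps)
    also have "x - y = 2 * ((x - y) / 2)" by simp
    also have "cos \<dots> = 1 - 2 * (sin ((x - y) / 2))\<^sup>2" by (rule cos_double_sin)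
    finally show ?thesis by (simp add: power_mult_distrib)
  qed
  then show ?thesis by (rule power2_eq_imp_eq) auto
qed

lemma poisson_nonneg: "cmod a \<le> 1 \<Longrightarrow> 0 \<le> poisson a t"
  by (simp add: poisson_def abs_square_le_1)

text \<open>The chord between two values of a Blaschke factor \<open>b\<close> can be computed exactly:
  \<open>b z - b w = (1 - (cmod a)\<^sup>2) * (z - w) / ((1 - cnj a * z) * (1 - cnj a * w))\<close>.\<close>
lemma sin_phase_diff:
  assumes a: "cmod a \<le> 1" and "cis s \<noteq> a" "cis t \<noteq> a"
  shows "\<bar>sin ((phase a t - phase a s) / 2)\<bar> = \<bar>sin ((t - s) / 2)\<bar> * sqrt (poisson a t * poisson a s)"
proof -
  have nz: "1 - cnj a * cis u \<noteq> 0" "cmod (1 - cnj a * cis u) = cmod (cis u - a)" if "cis u \<noteq> a" for u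
  proof -
    have "1 - cnj a * cis u = cnj (1 - a * cis (- u))" by (simp add: cis_cnj)
    then show "cmod (1 - cnj a * cis u) = cmod (cis u - a)"
      by (simp only: cmod_cis_diff_eq complex_mod_cnj)
    then show "1 - cnj a * cis u \<noteq> 0" using that by auto
  qed
  have "cis (phase a t) - cis (phase a s) =
     of_real (1 - (cmod a)\<^sup>2) * (cis t - cis s) / ((1 - cnj a * cis t) * (1 - cnj a * cis s))"
    using nz(1)[OF assms(2)] nz(1)[OF assms(3)] unfolding of_real_diff complex_norm_square of_real_1
    by (simp add: cis_phase assms divide_simps) (simp add: algebra_simps)
  then have "2 * \<bar>sin ((phase a t - phase a s) / 2)\<bar> =
     \<bar>1 - (cmod a)\<^sup>2\<bar> * (2 * \<bar>sin ((t - s) / 2)\<bar>) / (cmod (cis t - a) * cmod (cis s - a))"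
    unfolding chord_length[symmetric]
    by (simp only: norm_mult norm_divide nz(2) assms norm_of_real not_False_eq_True)
  also have "\<dots> = 2 * (\<bar>sin ((t - s) / 2)\<bar> * (\<bar>1 - (cmod a)\<^sup>2\<bar> / (cmod (cis t - a) * cmod (cis s - a))))"
    by simp
  also have "\<bar>1 - (cmod a)\<^sup>2\<bar> / (cmod (cis t - a) * cmod (cis s - a)) = sqrt (poisson a t * poisson a s)"
    by (simp add: poisson_def real_sqrt_mult real_sqrt_divide)
  finally show ?thesis by simp
qed

section \<open>The two-point inequality for several zeros\<close>

text \<open>The Cauchy-Schwarz inequality for two-term sums, in the form needed for the induction over
  the zeros.\<close>
lemma sqrt_mult_add_le:
  fixes x y X Y :: real
  assumes "0 \<le> x" "0 \<le> y" "0 \<le> X" "0 \<le> Y"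
  shows "sqrt (x * y) + sqrt (X * Y) \<le> sqrt ((x + X) * (y + Y))"
proof (rule real_le_rsqrt)
  have "0 \<le> (sqrt (x * Y) - sqrt (X * y))\<^sup>2" by simp
  also have "\<dots> = x * Y + X * y - 2 * (sqrt (x * y) * sqrt (X * Y))"
    using assms by (simp add: power2_diff real_sqrt_mult power_mult_distrib)
  finally have "0 \<le> x * Y + X * y - 2 * (sqrt (x * y) * sqrt (X * Y))" .
  moreover have "(sqrt (x * y) + sqrt (X * Y))\<^sup>2 = x * y + X * Y + 2 * (sqrt (x * y) * sqrt (X * Y))"
    using assms by (simp add: power2_sum real_sqrt_mult power_mult_distrib)
  ultimately show "(sqrt (x * y) + sqrt (X * Y))\<^sup>2 \<le> (x + X) * (y + Y)"
    by (simp add: algebra_simps)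
qed

lemma sum_poisson_nonneg:
  "\<forall>a\<in>#A. cmod a \<le> 1 \<Longrightarrow> 0 \<le> (\<Sum>a\<in>#A. poisson a t)"
  by (induction A) (auto intro!: add_nonneg_nonneg poisson_nonneg)

text \<open>Adding a zero adds its phase; the new sine is at most the sum of the two old ones, and
  the square roots recombine by Cauchy-Schwarz.\<close>
lemma sin_sum_phase_diff_le:
  assumes "\<forall>a\<in>#A. cmod a \<le> 1 \<and> cis s \<noteq> a \<and> cis t \<noteq> a"
  shows "\<bar>sin (((\<Sum>a\<in>#A. phase a t) - (\<Sum>a\<in>#A. phase a s)) / 2)\<bar>
       \<le> \<bar>sin ((t - s) / 2)\<bar> * sqrt ((\<Sum>a\<in>#A. poisson a t) * (\<Sum>a\<in>#A. poisson a s))"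
  using assms
proof (induction A)
  case (add b A)
  define x where "x = (phase b t - phase b s) / 2"
  define y where "y = ((\<Sum>a\<in>#A. phase a t) - (\<Sum>a\<in>#A. phase a s)) / 2"
  define S where "S = \<bar>sin ((t - s) / 2)\<bar>"
  have nn: "0 \<le> (\<Sum>a\<in>#A. poisson a u)" for u
    using add.prems by (intro sum_poisson_nonneg) auto
  have "\<bar>sin (x + y)\<bar> \<le> \<bar>sin x\<bar> * \<bar>cos y\<bar> + \<bar>cos x\<bar> * \<bar>sin y\<bar>"
    unfolding sin_add by (metis abs_mult abs_triangle_ineq)
  also have "\<dots> \<le> \<bar>sin x\<bar> * 1 + 1 * \<bar>sin y\<bar>"
    by (intro add_mono mult_mono) auto
  also have "\<dots> \<le> S * sqrt (poisson b t * poisson b s)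
       + S * sqrt ((\<Sum>a\<in>#A. poisson a t) * (\<Sum>a\<in>#A. poisson a s))"
    using add sin_phase_diff[of b s t] by (auto simp: x_def y_def S_def)
  also have "\<dots> = S * (sqrt (poisson b t * poisson b s)
       + sqrt ((\<Sum>a\<in>#A. poisson a t) * (\<Sum>a\<in>#A. poisson a s)))"
    by (simp add: algebra_simps)
  also have "\<dots> \<le> S * sqrt ((poisson b t + (\<Sum>a\<in>#A. poisson a t)) * (poisson b s + (\<Sum>a\<in>#A. poisson a s)))"
    using add.prems by (intro mult_left_mono sqrt_mult_add_le nn poisson_nonneg) (auto simp: S_def)
  also have "x + y = ((\<Sum>a\<in>#add_mset b A. phase a t) - (\<Sum>a\<in>#add_mset b A. phase a s)) / 2"
    by (simp add: x_def y_def field_simps)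
  finally show ?case by (simp add: S_def)
qed simp

lemma sum_phase_has_derivative:
  assumes "\<forall>a\<in>#A. cmod a \<le> 1 \<and> cis t \<noteq> a"
  shows "((\<lambda>t. \<Sum>a\<in>#A. phase a t) has_real_derivative (\<Sum>a\<in>#A. poisson a t)) (at t)"
  using assms
proof (induction A)
  case (add b A)
  then show ?case by (auto intro!: DERIV_add phase_has_derivative)
qed simp

text \<open>This provides the second-order expansion of the total phase that the cancellation of the
  poles of the two cotangents requires.\<close>
lemma sum_poisson_differentiable:
  assumes "\<forall>a\<in>#A. cis t \<noteq> a"
  shows "(\<lambda>t. \<Sum>a\<in>#A. poisson a t) differentiable at t"
  using assms
proof (induction A)
  case (add b A)
  have "(cmod (cis t - b))\<^sup>2 \<noteq> 0" using add.prems by simp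
  then have "(\<lambda>t. (1 - (cmod b)\<^sup>2) / ((cos t - Re b)\<^sup>2 + (sin t - Im b)\<^sup>2)) differentiable at t"
    unfolding cmod_power2 real_differentiable_def
    by (intro exI) (auto intro!: derivative_eq_intros)
  then have "poisson b differentiable at t"
    by (simp add: poisson_def[abs_def] cmod_power2)
  then show ?case using add by (auto intro!: differentiable_add)
qed simp

section \<open>From the two-point inequality to a bound on the initial rate\<close>

lemma cot_minus_inverse_tendsto: "((\<lambda>u. cot u - 1 / u) \<longlongrightarrow> 0) (at (0 :: real))"
  unfolding cot_def
proof -
  show "((\<lambda>u. cos u / sin u - 1 / u) \<longlongrightarrow> 0) (at (0 :: real))"
    by real_asymp
qed

lemma cot_antimono_on_0_pi:
  fixes x y :: real
  assumes "0 < x" "x \<le> y" "y < pi"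
  shows "cot y \<le> cot x"
proof -
  have "sin x > 0" "sin y > 0" using assms by (auto intro!: sin_gt_zero)
  moreover have "0 \<le> sin (y - x)" using assms by (intro sin_ge_zero) auto
  ultimately show ?thesis by (simp add: cot_def sin_diff divide_simps mult_ac)
qed

text \<open>The analytic core: a phase \<open>\<phi>\<close> with rate \<open>d\<close> that satisfies the two-point inequality against
  the point 0 and stays within \<open>\<beta>\<close> cannot start too fast. For \<open>\<phi> = arg\<close> of an automorphism of the
  disc the function \<open>G\<close> below is constant. Integrating the inequality from 0
  is impossible because both cotangents blow up there; instead \<open>G\<close> is compared, on either side,
  with its limit at 0.\<close>
lemma initial_rate_le:
  fixes \<phi> d :: "real \<Rightarrow> real"
  assumes \<alpha>: "0 < \<alpha>" "\<alpha> < pi" and \<beta>: "0 < \<beta>" "\<beta> < pi"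
    and deriv: "\<And>t. \<bar>t\<bar> < \<alpha> \<Longrightarrow> (\<phi> has_real_derivative d t) (at t)"
    and \<phi>0: "\<phi> 0 = 0"
    and d_diff: "d differentiable at 0"
    and bound: "\<And>t. \<bar>t\<bar> < \<alpha> \<Longrightarrow> \<bar>\<phi> t\<bar> \<le> \<beta>"
    and key: "\<And>t. \<bar>t\<bar> < \<alpha> \<Longrightarrow> (sin (\<phi> t / 2))\<^sup>2 \<le> (sin (t / 2))\<^sup>2 * (d t * d 0)"
  shows "d 0 \<le> tan (\<beta> / 2) / tan (\<alpha> / 2)"
proof (cases "d 0 > 0")
  case False
  moreover have "0 < tan (\<beta> / 2)" "0 < tan (\<alpha> / 2)" using \<alpha> \<beta> by (auto intro!: tan_gt_zero)
  ultimately show ?thesis by (smt (verit) divide_nonneg_nonneg)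
next
  case True
  define l where "l = d 0"
  have l: "l > 0" using True by (simp add: l_def)
  have sin_half: "sin (t / 2) \<noteq> 0" if "\<bar>t\<bar> < pi" "t \<noteq> 0" for t
    using that sin_gt_zero[of "t / 2"] sin_gt_zero[of "- t / 2"] by (cases "t > 0") auto
  have d_nonneg: "0 \<le> d t" if "\<bar>t\<bar> < \<alpha>" for t
  proof (cases "t = 0")
    case True then show ?thesis using l by (simp add: l_def)
  next
    case False
    then have "0 < (sin (t / 2))\<^sup>2" using sin_half[of t] that \<alpha> by auto
    moreover have "0 \<le> (sin (t / 2))\<^sup>2 * (d t * d 0)" by (rule order_trans[OF _ key[OF that]]) simp
    ultimately show ?thesis using l by (simp add: l_def zero_le_mult_iff)
  qed
  have mono: "\<phi> s \<le> \<phi> t" if "s \<le> t" "\<bar>s\<bar> < \<alpha>" "\<bar>t\<bar> < \<alpha>" for s t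
    using that by (intro DERIV_nonneg_imp_nondecreasing[OF that(1)]) (meson abs_less_iff deriv d_nonneg le_less_trans less_le_trans neg_le_iff_le)
  \<comment> \<open>Monotonicity alone gives \<open>\<le>\<close>; the strict sign, needed for the cotangent of \<open>\<phi>\<close> to be
    finite away from 0, comes from the positive derivative at 0.\<close>
  have pos: "0 < \<phi> t" if "0 < t" "t < \<alpha>" for t
  proof -
    obtain e where e: "e > 0" "\<And>h. h > 0 \<Longrightarrow> h < e \<Longrightarrow> \<phi> 0 < \<phi> (0 + h)"
      using DERIV_pos_inc_right[OF deriv[of 0]] \<alpha> l by (auto simp: l_def)
    have "0 < \<phi> (min t (e / 2))" using e(2)[of "min t (e / 2)"] e(1) that by (simp add: \<phi>0)
    also have "\<dots> \<le> \<phi> t" using that e(1) by (intro mono) auto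
    finally show ?thesis .
  qed
  have neg: "\<phi> t < 0" if "t < 0" "- t < \<alpha>" for t
  proof -
    obtain e where e: "e > 0" "\<And>h. h > 0 \<Longrightarrow> h < e \<Longrightarrow> \<phi> (0 - h) < \<phi> 0"
      using DERIV_pos_inc_left[OF deriv[of 0]] \<alpha> l by (auto simp: l_def)
    have "\<phi> t \<le> \<phi> (0 - min (- t) (e / 2))" using that e(1) by (intro mono) auto
    also have "\<dots> < 0" using e(2)[of "min (- t) (e / 2)"] e(1) that by (simp add: \<phi>0)
    finally show ?thesis .
  qed
  have \<phi>nz: "\<phi> t \<noteq> 0" if "\<bar>t\<bar> < \<alpha>" "t \<noteq> 0" for t
    using pos[of t] neg[of t] that by linarith
  define G where "G = (\<lambda>t. cot (\<phi> t / 2) - cot (t / 2) / l)"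
  have G_decr: "G t \<le> G s" if "s \<le> t" "\<And>u. s \<le> u \<Longrightarrow> u \<le> t \<Longrightarrow> \<bar>u\<bar> < \<alpha> \<and> u \<noteq> 0" for s t
  proof (rule DERIV_nonpos_imp_nonincreasing[OF that(1)])
    fix u assume "s \<le> u" "u \<le> t"
    with that(2) have u: "\<bar>u\<bar> < \<alpha>" "u \<noteq> 0" by auto
    have s1: "sin (\<phi> u / 2) \<noteq> 0" using sin_half[of "\<phi> u"] \<phi>nz[OF u] bound[OF u(1)] \<beta> by auto
    have s2: "sin (u / 2) \<noteq> 0" using sin_half[of u] u \<alpha> by auto
    have "(cot has_real_derivative - inverse ((sin (\<phi> u / 2))\<^sup>2)) (at (\<phi> u / 2))"
      "(cot has_real_derivative - inverse ((sin (u / 2))\<^sup>2)) (at (u / 2))"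
      using s1 s2 by simp_all
    then have "(G has_real_derivative (- inverse ((sin (\<phi> u / 2))\<^sup>2) * (d u / 2)
        - - inverse ((sin (u / 2))\<^sup>2) * (1 / 2) / l)) (at u)"
      unfolding G_def
      by (intro DERIV_diff DERIV_cdivide DERIV_chain2[where f = cot] deriv[OF u(1)] DERIV_ident)
    moreover have "- inverse ((sin (\<phi> u / 2))\<^sup>2) * (d u / 2)
        - - inverse ((sin (u / 2))\<^sup>2) * (1 / 2) / l \<le> 0"
    proof -
      have "(sin (\<phi> u / 2))\<^sup>2 > 0" "(sin (u / 2))\<^sup>2 > 0" using s1 s2 by auto
      then show ?thesis using key[OF u(1)] l by (simp add: l_def[symmetric] field_simps)
    qed
    ultimately show "\<exists>y. (G has_real_derivative y) (at u) \<and> y \<le> 0" by blast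
  qed
  obtain m where m: "(d has_real_derivative m) (at 0)"
    using d_diff by (auto simp: real_differentiable_def)
  have ev: "eventually (\<lambda>t. \<bar>t\<bar> < \<alpha> \<and> t \<noteq> 0) (at 0)"
    using \<alpha> by (auto simp: eventually_at intro!: exI[of _ \<alpha>])
  have \<phi>_lim: "(\<phi> \<longlongrightarrow> 0) (at 0)"
    using DERIV_isCont[OF deriv[of 0]] \<alpha> by (simp add: isCont_def \<phi>0)
  have quot: "((\<lambda>t. \<phi> t / t) \<longlongrightarrow> l) (at 0)"
    using deriv[of 0] \<alpha> by (simp add: has_field_derivative_iff \<phi>0 l_def)
  \<comment> \<open>The limit \<open>m / 2\<close> is the quadratic Taylor coefficient of \<open>\<phi>\<close> at 0.\<close>
  have second: "((\<lambda>t. (\<phi> t - l * t) / t\<^sup>2) \<longlongrightarrow> m / 2) (at 0)"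
  proof (rule lhopital[where f' = "\<lambda>t. d t - l" and g' = "\<lambda>t. 2 * t"])
    show "((\<lambda>t. \<phi> t - l * t) \<longlongrightarrow> 0) (at 0)" by (rule tendsto_eq_intros \<phi>_lim refl | simp)+
    show "((\<lambda>t::real. t\<^sup>2) \<longlongrightarrow> 0) (at 0)" by (rule tendsto_eq_intros refl | simp)+
    show "\<forall>\<^sub>F t in at 0. DERIV (\<lambda>t. \<phi> t - l * t) t :> d t - l"
      by (rule eventually_mono[OF ev]) (auto intro!: derivative_eq_intros deriv)
    show "((\<lambda>t. (d t - l) / (2 * t)) \<longlongrightarrow> m / 2) (at 0)"
      using tendsto_divide[OF m[unfolded has_field_derivative_iff] tendsto_const[of 2]]
      by (simp add: l_def mult.commute)
    show "\<forall>\<^sub>F t in at 0. DERIV (\<lambda>t. t\<^sup>2) t :> 2 * t"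
      by (auto intro!: always_eventually derivative_eq_intros)
  qed (auto simp: eventually_at_filter)
  \<comment> \<open>The poles of \<open>cot (\<phi> t / 2)\<close> and \<open>cot (t / 2) / l\<close> cancel. What remains at 0 is \<open>L\<close>, from
    \<open>2 / (l * t + m * t\<^sup>2 / 2) = 2 / (l * t) - m / l\<^sup>2 + o(1)\<close>.\<close>
  define L where "L = - (m / l\<^sup>2)"
  have "((\<lambda>t. 2 / \<phi> t - 2 / (l * t)) \<longlongrightarrow> L) (at 0)"
  proof (rule Lim_transform_eventually)
    show "((\<lambda>t. - 2 * ((\<phi> t - l * t) / t\<^sup>2) / (l * (\<phi> t / t))) \<longlongrightarrow> L) (at 0)"
      by (rule tendsto_eq_intros second quot refl | use l in \<open>simp add: L_def power2_eq_square\<close>)+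
    show "\<forall>\<^sub>F t in at 0. - 2 * ((\<phi> t - l * t) / t\<^sup>2) / (l * (\<phi> t / t)) = 2 / \<phi> t - 2 / (l * t)"
    proof (rule eventually_mono[OF ev])
      fix t assume "\<bar>t\<bar> < \<alpha> \<and> t \<noteq> 0"
      then have "\<phi> t \<noteq> 0" "t \<noteq> 0" using \<phi>nz by auto
      then show "- 2 * ((\<phi> t - l * t) / t\<^sup>2) / (l * (\<phi> t / t)) = 2 / \<phi> t - 2 / (l * t)"
        using l by (simp add: field_simps power2_eq_square)
    qed
  qed
  moreover have "((\<lambda>t. cot (\<phi> t / 2) - 1 / (\<phi> t / 2)) \<longlongrightarrow> 0) (at 0)"
  proof (rule filterlim_compose[OF cot_minus_inverse_tendsto])
    show "LIM t at 0. \<phi> t / 2 :> at 0"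
      using eventually_mono[OF ev, of "\<lambda>t. \<phi> t / 2 \<in> UNIV \<and> \<phi> t / 2 \<noteq> 0"]
        tendsto_divide[OF \<phi>_lim tendsto_const[of 2]] \<phi>nz
      by (simp add: filterlim_at)
  qed
  moreover have "((\<lambda>t::real. cot (t / 2) - 1 / (t / 2)) \<longlongrightarrow> 0) (at 0)"
  proof (rule filterlim_compose[OF cot_minus_inverse_tendsto])
    show "LIM t at 0. t / 2 :> at (0 :: real)"
      unfolding filterlim_at
      by (intro conjI eventually_mono[OF ev] tendsto_eq_intros) auto
  qed
  ultimately have "((\<lambda>t. (2 / \<phi> t - 2 / (l * t)) + (cot (\<phi> t / 2) - 1 / (\<phi> t / 2))
      - (cot (t / 2) - 1 / (t / 2)) / l) \<longlongrightarrow> L + 0 - 0 / l) (at 0)"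
    by (intro tendsto_intros) (use l in auto)
  then have G_lim: "(G \<longlongrightarrow> L) (at 0)"
    by (simp add: G_def algebra_simps diff_divide_distrib)
  \<comment> \<open>\<open>G\<close> decreases to the left and to the right of 0, so \<open>G t \<le> L \<le> G (- t)\<close>.\<close>
  have le: "l \<le> tan (\<beta> / 2) / tan (t / 2)" if t: "0 < t" "t < \<alpha>" for t
  proof -
    have "G t \<le> L"
    proof (rule tendsto_lowerbound)
      show "(G \<longlongrightarrow> L) (at_right 0)" using G_lim by (rule filterlim_mono) (auto simp: at_le)
      show "\<forall>\<^sub>F s in at_right 0. G t \<le> G s"
        using eventually_at_right_less eventually_at_right_real[OF t(1)]
        by eventually_elim (use t in \<open>auto intro!: G_decr\<close>)
    qed simp
    moreover have "L \<le> G (- t)"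
    proof (rule tendsto_upperbound)
      show "(G \<longlongrightarrow> L) (at_left 0)" using G_lim by (rule filterlim_mono) (auto simp: at_le)
      show "\<forall>\<^sub>F s in at_left 0. G s \<le> G (- t)"
        using eventually_at_left_real[of "- t" 0] t
        by (auto elim!: eventually_mono intro!: G_decr)
    qed simp
    moreover have "cot (\<beta> / 2) \<le> cot (\<phi> t / 2)"
      using pos[OF t] bound[of t] t \<beta> by (intro cot_antimono_on_0_pi) auto
    moreover have "cot (\<beta> / 2) \<le> cot (- \<phi> (- t) / 2)"
      using neg[of "- t"] bound[of "- t"] t \<beta> by (intro cot_antimono_on_0_pi) auto
    ultimately have "cot (\<beta> / 2) \<le> cot (t / 2) / l"
      by (simp add: G_def cot_def)
    moreover have "0 < tan (\<beta> / 2)" "0 < tan (t / 2)" using \<alpha> \<beta> t by (auto intro!: tan_gt_zero)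
    ultimately show ?thesis using l by (simp add: cot_altdef field_simps)
  qed
  have "l \<le> tan (\<beta> / 2) / tan (\<alpha> / 2)"
  proof (rule tendsto_lowerbound)
    have "tan (\<alpha> / 2) \<noteq> 0" "cos (\<alpha> / 2) \<noteq> 0"
      using tan_gt_zero[of "\<alpha> / 2"] cos_gt_zero[of "\<alpha> / 2"] \<alpha> by auto
    then show "((\<lambda>t. tan (\<beta> / 2) / tan (t / 2)) \<longlongrightarrow> tan (\<beta> / 2) / tan (\<alpha> / 2)) (at_left \<alpha>)"
      by (intro tendsto_intros) auto
    show "\<forall>\<^sub>F t in at_left \<alpha>. l \<le> tan (\<beta> / 2) / tan (t / 2)"
      using eventually_at_left_real[OF \<alpha>(1)] by (rule eventually_mono) (auto intro: le)
  qed simp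
  then show ?thesis by (simp add: l_def)
qed

section \<open>Arguments of polynomials along the circle\<close>

lemma cis_linear_factor:
  assumes "cmod a \<le> 1" "cis t \<noteq> a"
  shows "cis t - a = rcis (cmod (cis t - a)) ((t + phase a t) / 2)"
proof -
  define w where "w = 1 - a * cis (- t)"
  have "Re w > 0" using Re_one_minus_rotation_pos[OF assms] by (simp add: w_def)
  then have w0: "w \<noteq> 0" by auto
  have "cis t - a = cis t * w" by (simp add: w_def cis_diff_eq[of t a])
  also have "\<dots> = of_real (cmod w) * (cis t * cis (Im (Ln w)))"
    using w0 by (simp add: cis_Im_Ln)
  also have "\<dots> = rcis (cmod (cis t - a)) ((t + phase a t) / 2)"
    by (simp add: cis_mult rcis_def cmod_cis_diff_eq phase_def w_def add_divide_distrib)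
  finally show ?thesis .
qed

lemma prod_linear_factors_polar:
  assumes "\<forall>a\<in>#A. cmod a \<le> 1 \<and> cis t \<noteq> a"
  shows "(\<Prod>a\<in>#A. cis t - a) = rcis (cmod (\<Prod>a\<in>#A. cis t - a)) ((real (size A) * t + (\<Sum>a\<in>#A. phase a t)) / 2)"
  using assms
proof (induction A)
  case (add b A)
  have "(\<Prod>a\<in>#add_mset b A. cis t - a) = (cis t - b) * (\<Prod>a\<in>#A. cis t - a)" by simp
  also have "\<dots> = rcis (cmod (cis t - b)) ((t + phase b t) / 2)
      * rcis (cmod (\<Prod>a\<in>#A. cis t - a)) ((real (size A) * t + (\<Sum>a\<in>#A. phase a t)) / 2)"
    using add cis_linear_factor[of b t] by auto
  also have "\<dots> = rcis (cmod (\<Prod>a\<in>#add_mset b A. cis t - a))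
       ((real (size (add_mset b A)) * t + (\<Sum>a\<in>#add_mset b A. phase a t)) / 2)"
    unfolding rcis_mult by (rule arg_cong2[of _ _ _ _ rcis]) (simp add: norm_mult, simp add: field_simps)
  finally show ?case .
qed simp

lemma poly_prod_mset: "poly (\<Prod>a\<in>#A. [:- a, 1:]) z = (\<Prod>a\<in>#A. z - a)"
  for z :: "'a :: comm_ring_1"
  by (induction A) (auto simp: algebra_simps)

lemma degree_prod_mset: "degree (\<Prod>a\<in>#A. [:- a, 1:]) = size A"
  for A :: "'a :: idom multiset"
proof (induction A)
  case (add a A)
  have "(\<Prod>a\<in>#A. [:- a, 1:]) \<noteq> 0" by (auto simp: prod_mset_zero_iff)
  then show ?case using add by (simp del: mult_pCons_left add: degree_mult_eq)
qed simp

lemma poly_cis_polar: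
  assumes P: "P = smult c (\<Prod>a\<in>#A. [:- a, 1:])" and c: "c \<noteq> 0"
    and A: "\<forall>a\<in>#A. cmod a \<le> 1 \<and> cis t \<noteq> a"
  shows "poly P (cis t) \<noteq> 0"
    and "poly P (cis t) = rcis (cmod (poly P (cis t)))
           (Arg c + (real (degree P) * t + (\<Sum>a\<in>#A. phase a t)) / 2)"
proof -
  have deg: "degree P = size A" using c by (simp add: P degree_prod_mset)
  have val: "poly P (cis t) = c * (\<Prod>a\<in>#A. cis t - a)" by (simp add: P poly_prod_mset)
  show "poly P (cis t) \<noteq> 0" using A c by (auto simp: val prod_mset_zero_iff)
  have "poly P (cis t) = rcis (cmod c) (Arg c) * rcis (cmod (\<Prod>a\<in>#A. cis t - a))
      ((real (size A) * t + (\<Sum>a\<in>#A. phase a t)) / 2)"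
    unfolding val rcis_cmod_Arg prod_linear_factors_polar[OF A, symmetric] ..
  then show "poly P (cis t) = rcis (cmod (poly P (cis t)))
           (Arg c + (real (degree P) * t + (\<Sum>a\<in>#A. phase a t)) / 2)"
    by (simp add: rcis_mult deg val norm_mult)
qed

text \<open>A curve on the circle given by its angle \<open>u\<close> comes with explicit branches: \<open>u\<close> for \<open>arg z\<close>
  and half of \<open>n * u\<close> plus the total phase for \<open>arg P\<close>. In \<open>2 arg P - n arg z\<close> the angle
  \<open>u\<close> cancels.\<close>
lemma curve_increment_cis:
  assumes P: "P = smult c (\<Prod>a\<in>#A. [:- a, 1:])" and c: "c \<noteq> 0"
    and u: "continuous_on {0..1} u" "\<And>s. s \<in> {0..1} \<Longrightarrow> g s = cis (u s)"
    and A: "\<And>s. s \<in> {0..1} \<Longrightarrow> \<forall>a\<in>#A. cmod a \<le> 1 \<and> cis (u s) \<noteq> a"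
  shows "curve_increment P g = (\<Sum>a\<in>#A. phase a (u 1)) - (\<Sum>a\<in>#A. phase a (u 0))"
proof -
  define \<psi> where
    "\<psi> = (\<lambda>s. Arg c + (real (degree P) * u s + (\<Sum>a\<in>#A. phase a (u s))) / 2)"
  have "isCont (\<lambda>t. \<Sum>a\<in>#A. phase a t) (u s)" if "s \<in> {0..1}" for s
    using DERIV_isCont[OF sum_phase_has_derivative[OF A[OF that]]] .
  then have "continuous_on (u ` {0..1}) (\<lambda>t. \<Sum>a\<in>#A. phase a t)"
    by (auto intro!: continuous_at_imp_continuous_on)
  from continuous_on_compose[OF u(1) this]
  have "continuous_on {0..1} \<psi>"
    unfolding \<psi>_def by (intro continuous_intros u(1)) (auto simp: o_def)
  then have "arg_branch (poly P \<circ> g) {0..1} \<psi>"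
    using poly_cis_polar[OF P c A] u(2) by (auto simp: arg_branch_def \<psi>_def)
  moreover have "arg_branch g {0..1} u"
    using u by (auto simp: arg_branch_def rcis_def)
  ultimately show ?thesis
    by (simp add: curve_increment_def arg_increment_eq \<psi>_def field_simps)
qed

text \<open>The same explicit branch of \<open>arg P\<close>, defined near any point of the circle that is not a
  zero, is differentiable, so its derivative is the one that \<open>Lambda\<close> refers to.\<close>
lemma Lambda_eq_sum_poisson:
  assumes P: "P = smult c (\<Prod>a\<in>#A. [:- a, 1:])" and c: "c \<noteq> 0"
    and A: "\<forall>a\<in>#A. cmod a \<le> 1 \<and> cis t \<noteq> a"
  shows "Lambda P (cis t) = (\<Sum>a\<in>#A. poisson a t)"
proof -
  \<comment> \<open>\<open>Lambda\<close> works at the principal argument, which may differ from \<open>t\<close> by a multiple of \<open>2 * pi\<close>.\<close>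
  define \<theta> where "\<theta> = Arg (cis t)"
  have cis_\<theta>: "cis \<theta> = cis t" by (simp add: \<theta>_def cis_Arg sgn_eq)
  define U where "U = (\<Inter>a\<in>set_mset A. {s. cis s \<noteq> a})"
  define \<psi> where "\<psi> = (\<lambda>s. Arg c + (real (degree P) * s + (\<Sum>a\<in>#A. phase a s)) / 2)"
  define d where "d = (real (degree P) + (\<Sum>a\<in>#A. poisson a \<theta>)) / 2"
  have U: "open U" "\<theta> \<in> U"
    unfolding U_def using A cis_\<theta> by (auto intro!: open_INT open_Collect_neq continuous_intros)
  have AU: "\<forall>a\<in>#A. cmod a \<le> 1 \<and> cis s \<noteq> a" if "s \<in> U" for s using that A by (auto simp: U_def)
  have der: "(\<psi> has_real_derivative d) (at s)" if "s = \<theta>" for s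
    unfolding \<psi>_def d_def that
    by (rule derivative_eq_intros sum_phase_has_derivative[OF AU[OF U(2)]] refl | simp)+
  have "isCont \<psi> s" if "s \<in> U" for s
    unfolding \<psi>_def
    by (intro continuous_intros DERIV_isCont[OF sum_phase_has_derivative[OF AU[OF that]]]) auto
  then have br: "arg_branch (\<lambda>s. poly P (cis s)) U \<psi>"
    using poly_cis_polar[OF P c AU]
    by (auto simp: arg_branch_def \<psi>_def intro!: continuous_at_imp_continuous_on)
  have f: "((\<lambda>s. poly P (cis s)) has_vector_derivative \<i> * cis \<theta> * poly (pderiv P) (cis \<theta>)) (at \<theta>)"
    using field_vector_diff_chain_at[OF cis_has_vector_derivative poly_DERIV] by (simp add: o_def)
  have "arg_deriv (\<lambda>s. poly P (cis s)) \<theta> = d"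
    unfolding arg_deriv_def
    using U br der[OF refl] arg_branch_deriv_unique[OF _ _ _ _ f]
    by (intro the_equality) (blast, metis)
  then show ?thesis by (simp add: Lambda_def d_def poisson_def cis_\<theta> flip: \<theta>_def)
qed

section \<open>The inequality and its extremal polynomials\<close>

text \<open>The curves that run monotonically from \<open>z0\<close> along the arc already give the bound \<open>\<beta>\<close> on the
  total phase, measured from \<open>z0\<close>; then \<open>initial_rate_le\<close> applies.\<close>

lemma Lambda_le_of_increment_bounded:
  assumes deg: "degree P \<ge> 1" and roots: "\<forall>z. poly P z = 0 \<longrightarrow> cmod z \<le> 1"
    and z0: "cmod z0 = 1" and \<alpha>: "0 < \<alpha>" "\<alpha> < pi"
    and free: "\<forall>z \<in> circle_arc z0 \<alpha>. poly P z \<noteq> 0"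
    and \<beta>: "0 < \<beta>" "\<beta> < pi" and incr: "increment_bounded P z0 \<alpha> \<beta>"
  shows "Lambda P z0 \<le> tan (\<beta> / 2) / tan (\<alpha> / 2)"
proof -
  have "P \<noteq> 0" using deg by auto
  then obtain A where P: "P = smult (lead_coeff P) (\<Prod>a\<in>#A. [:- a, 1:])"
    using alg_closed_imp_factorization by blast
  have c: "lead_coeff P \<noteq> 0" using \<open>P \<noteq> 0\<close> by simp
  have val: "poly P z = lead_coeff P * (\<Prod>a\<in>#A. z - a)" for z
    by (subst P) (simp add: poly_prod_mset)
  have root: "poly P a = 0" if "a \<in># A" for a
    using that by (auto simp: val prod_mset_zero_iff)
  define \<theta> where "\<theta> = Arg z0"
  have z0_eq: "z0 = cis \<theta>" using z0 rcis_cmod_Arg[of z0] by (simp add: \<theta>_def rcis_def)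
  have A: "\<forall>a\<in>#A. cmod a \<le> 1 \<and> cis (\<theta> + t) \<noteq> a" if "\<bar>t\<bar> < \<alpha>" for t
  proof -
    have "cis (\<theta> + t) \<in> circle_arc z0 \<alpha>"
      using that by (auto simp: circle_arc_def z0_eq cis_mult)
    then show ?thesis using roots root free by auto
  qed
  define \<phi> where "\<phi> = (\<lambda>t. (\<Sum>a\<in>#A. phase a (\<theta> + t)) - (\<Sum>a\<in>#A. phase a \<theta>))"
  define d where "d = (\<lambda>t. \<Sum>a\<in>#A. poisson a (\<theta> + t))"
  have "d 0 \<le> tan (\<beta> / 2) / tan (\<alpha> / 2)"
  proof (rule initial_rate_le[OF \<alpha> \<beta>])
    show "\<phi> 0 = 0" by (simp add: \<phi>_def)
    show "(\<phi> has_real_derivative d t) (at t)" if "\<bar>t\<bar> < \<alpha>" for t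
      unfolding \<phi>_def d_def
      using sum_phase_has_derivative[OF A[OF that]]
        DERIV_shift[of "\<lambda>t. \<Sum>a\<in>#A. phase a t" _ t \<theta>]
      by (auto intro!: derivative_eq_intros simp: add.commute[of \<theta>])
    show "d differentiable at 0"
      using sum_poisson_differentiable[of A \<theta>] A[of 0] \<alpha>
      by (auto simp: real_differentiable_def d_def add.commute[of \<theta>] DERIV_shift[of _ _ 0 \<theta>, simplified])
    show "\<bar>\<phi> t\<bar> \<le> \<beta>" if t: "\<bar>t\<bar> < \<alpha>" for t
    proof -
      define u where "u = (\<lambda>s. \<theta> + s * t)"
      have small: "\<bar>s * t\<bar> < \<alpha>" if "s \<in> {0..1}" for s
      proof -
        have "\<bar>s * t\<bar> \<le> \<bar>t\<bar>" using that by (simp add: abs_mult mult_left_le_one_le)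
        with t show ?thesis by linarith
      qed
      have "path (cis \<circ> u)" unfolding path_def u_def o_def by (intro continuous_intros)
      moreover have "path_image (cis \<circ> u) \<subseteq> circle_arc z0 \<alpha>"
        using small by (fastforce simp: path_image_def circle_arc_def u_def z0_eq cis_mult)
      moreover have "pathstart (cis \<circ> u) = z0" by (simp add: pathstart_def u_def z0_eq)
      ultimately have "\<bar>curve_increment P (cis \<circ> u)\<bar> \<le> \<beta>"
        using incr unfolding increment_bounded_def by blast
      also have "curve_increment P (cis \<circ> u) = (\<Sum>a\<in>#A. phase a (u 1)) - (\<Sum>a\<in>#A. phase a (u 0))"
        using small A by (intro curve_increment_cis[OF P c]) (auto simp: u_def intro!: continuous_intros)
      finally show ?thesis by (simp add: u_def \<phi>_def)
    qed
    show "(sin (\<phi> t / 2))\<^sup>2 \<le> (sin (t / 2))\<^sup>2 * (d t * d 0)" if "\<bar>t\<bar> < \<alpha>" for t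
    proof -
      have "\<bar>sin (\<phi> t / 2)\<bar> \<le> \<bar>sin (t / 2)\<bar> * sqrt (d t * d 0)"
        using sin_sum_phase_diff_le[of A \<theta> "\<theta> + t"] A[OF that] A[of 0] \<alpha>(1)
        by (simp add: \<phi>_def d_def)
      then have "\<bar>sin (\<phi> t / 2)\<bar>\<^sup>2 \<le> (\<bar>sin (t / 2)\<bar> * sqrt (d t * d 0))\<^sup>2"
        by (intro power_mono) auto
      moreover have "0 \<le> d t * d 0"
        unfolding d_def using A[OF that] by (intro mult_nonneg_nonneg sum_poisson_nonneg) auto
      ultimately show ?thesis by (simp add: power_mult_distrib)
    qed
  qed
  moreover have "Lambda P z0 = d 0"
    unfolding z0_eq d_def using Lambda_eq_sum_poisson[OF P c, of \<theta>] A[of 0] \<alpha> by simp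
  ultimately show ?thesis by simp
qed

text \<open>On the unit circle the numerator of the Poisson kernel is 0, so the phase of a zero on the
  circle has rate 0 away from that zero.\<close>
lemma phase_unimodular_const:
  assumes a: "cmod a = 1" "a \<notin> circle_arc 1 \<alpha>" and "\<bar>s\<bar> < \<alpha>" "\<bar>t\<bar> < \<alpha>"
  shows "phase a s = phase a t"
proof -
  have "\<exists>k. \<forall>x\<in>{- \<alpha><..<\<alpha>}. phase a x = k"
  proof (rule has_field_derivative_zero_constant)
    fix x assume "x \<in> {- \<alpha><..<\<alpha>}"
    then have "\<bar>x\<bar> < \<alpha>" by auto
    then have "cis x \<noteq> a" using a(2) by (auto simp: circle_arc_def)
    then have "(phase a has_real_derivative poisson a x) (at x)"
      using a(1) by (intro phase_has_derivative) auto
    then show "(phase a has_field_derivative 0) (at x within {- \<alpha><..<\<alpha>})"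
      using a(1) by (auto simp: poisson_def intro: has_field_derivative_at_within)
  qed auto
  then show ?thesis using assms(3,4) by (metis abs_less_iff greaterThanLessThan_iff minus_less_iff)
qed

text \<open>As \<open>\<alpha> < pi\<close>, the arc avoids the negative real axis, so the principal argument is a
  continuous angle along the path.\<close>
lemma path_in_circle_arc_lift:
  assumes "path g" "path_image g \<subseteq> circle_arc 1 \<alpha>" "\<alpha> < pi"
  obtains u where "continuous_on {0..1} u"
    "\<And>s. s \<in> {0..1} \<Longrightarrow> \<bar>u s\<bar> < \<alpha>" "\<And>s. s \<in> {0..1} \<Longrightarrow> g s = cis (u s)"
proof
  have g: "\<exists>t. \<bar>t\<bar> < \<alpha> \<and> g s = cis t" if "s \<in> {0..1}" for s
    using that assms(2) by (force simp: path_image_def circle_arc_def)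
  have Ln: "Im (Ln (g s)) = t" if "g s = cis t" "\<bar>t\<bar> < \<alpha>" for s t
    using that assms(3) by (simp add: cis_conv_exp)
  show "\<bar>Im (Ln (g s))\<bar> < \<alpha>" "g s = cis (Im (Ln (g s)))" if "s \<in> {0..1}" for s
    using g[OF that] Ln by metis+
  have "g s \<notin> \<real>\<^sub>\<le>\<^sub>0" if s: "s \<in> {0..1}" for s
  proof
    assume neg: "g s \<in> \<real>\<^sub>\<le>\<^sub>0"
    obtain t where t: "\<bar>t\<bar> < \<alpha>" "g s = cis t" using g[OF s] by blast
    then have "g s \<noteq> 0" by simp
    with neg have "Im (Ln (g s)) = pi"
      by (auto simp: complex_nonpos_Reals_iff Im_Ln_eq_pi complex_eq_iff)
    then show False using Ln[of s t] t assms(3) by auto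
  qed
  then show "continuous_on {0..1} (\<lambda>s. Im (Ln (g s)))"
    using assms(1) by (intro continuous_intros) (auto simp: path_def)
qed

text \<open>The zeros on the circle have constant phase, and the zero at the origin has phase \<open>t\<close>, so the
  increment along a curve is its change of angle, at most \<open>\<alpha>\<close> when one end is the centre of
  the arc.\<close>
lemma extremal_polynomial:
  fixes a :: "nat \<Rightarrow> complex"
  assumes n: "n \<ge> 1" and P: "P = smult c ([:0, 1:] * (\<Prod>k = 2..n. [:- a k, 1:]))" and c: "c \<noteq> 0"
    and a: "\<forall>k \<in> {2..n}. cmod (a k) = 1 \<and> a k \<noteq> 1"
    and \<alpha>: "0 < \<alpha>" "\<alpha> < pi" and free: "\<forall>k \<in> {2..n}. a k \<notin> circle_arc 1 \<alpha>"
  shows "degree P = n" "\<forall>z. poly P z = 0 \<longrightarrow> cmod z \<le> 1"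
    "\<forall>z \<in> circle_arc 1 \<alpha>. poly P z \<noteq> 0" "increment_bounded P 1 \<alpha> \<alpha>" "Lambda P 1 = 1"
proof -
  define M where "M = image_mset a (mset_set {2..n})"
  define A where "A = add_mset 0 M"
  have M: "cmod b = 1" "b \<noteq> 1" "b \<notin> circle_arc 1 \<alpha>" if "b \<in># M" for b
    using that a free by (auto simp: M_def)
  have PA: "P = smult c (\<Prod>a\<in>#A. [:- a, 1:])"
    by (simp add: P A_def M_def prod_unfold_prod_mset image_mset.compositionality o_def)
  show "degree P = n" using n c unfolding PA degree_smult_eq degree_prod_mset by (simp add: A_def M_def)
  have val: "poly P z = c * (\<Prod>a\<in>#A. z - a)" for z by (simp add: PA poly_prod_mset)
  have root: "poly P z = 0 \<longleftrightarrow> z \<in># A" for z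
    using c by (auto simp: val prod_mset_zero_iff)
  show "\<forall>z. poly P z = 0 \<longrightarrow> cmod z \<le> 1" using M by (auto simp: root A_def)
  show "\<forall>z \<in> circle_arc 1 \<alpha>. poly P z \<noteq> 0"
    using M by (auto simp: root A_def circle_arc_def)
  have avoid: "\<forall>a\<in>#A. cmod a \<le> 1 \<and> cis t \<noteq> a" if "\<bar>t\<bar> < \<alpha>" for t
    using M that by (auto simp: A_def circle_arc_def)
  show "increment_bounded P 1 \<alpha> \<alpha>"
    unfolding increment_bounded_def
  proof (intro allI impI)
    fix g assume g: "path g \<and> path_image g \<subseteq> circle_arc 1 \<alpha> \<and> (pathstart g = 1 \<or> pathfinish g = 1)"
    then obtain u where u: "continuous_on {0..1} u" "\<And>s. s \<in> {0..1} \<Longrightarrow> \<bar>u s\<bar> < \<alpha>"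
      "\<And>s. s \<in> {0..1} \<Longrightarrow> g s = cis (u s)"
      using path_in_circle_arc_lift \<alpha>(2) by metis
    \<comment> \<open>The lift vanishes at an end point equal to 1, since \<open>\<bar>u s\<bar> < pi\<close>.\<close>
    have zero: "u s = 0" if "s \<in> {0..1}" "g s = 1" for s
    proof -
      have "Im (Ln (cis (u s))) = u s" using u(2)[OF that(1)] \<alpha> by (simp add: cis_conv_exp)
      then show ?thesis using u(3)[OF that(1)] that(2) by simp
    qed
    have "curve_increment P g = (\<Sum>a\<in>#A. phase a (u 1)) - (\<Sum>a\<in>#A. phase a (u 0))"
      using u avoid by (intro curve_increment_cis[OF PA c]) auto
    also have "(\<Sum>a\<in>#M. phase a (u 1)) = (\<Sum>a\<in>#M. phase a (u 0))"
      using M u(2)[of 0] u(2)[of 1]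
      by (intro arg_cong[where f = sum_mset] image_mset_cong phase_unimodular_const[of _ \<alpha>]) auto
    then have "(\<Sum>a\<in>#A. phase a (u 1)) - (\<Sum>a\<in>#A. phase a (u 0)) = u 1 - u 0"
      by (simp add: A_def phase_def[of 0])
    finally show "\<bar>curve_increment P g\<bar> \<le> \<alpha>"
      using g zero[of 0] zero[of 1] u(2)[of 0] u(2)[of 1]
      by (auto simp: pathstart_def pathfinish_def)
  qed
  have "Lambda P (cis 0) = (\<Sum>a\<in>#A. poisson a 0)"
    using avoid[of 0] \<alpha> by (intro Lambda_eq_sum_poisson[OF PA c]) auto
  moreover have "(\<Sum>a\<in>#M. poisson a 0) = (\<Sum>a\<in>#M. 0)"
    using M by (intro arg_cong[where f = sum_mset] image_mset_cong) (auto simp: poisson_def)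
  ultimately show "Lambda P 1 = 1" by (simp add: A_def poisson_def[of 0])
qed

theorem theorem3:
  fixes n :: nat
  assumes "n \<ge> 1"
  shows "(\<forall>(P :: complex poly) (z0 :: complex) (\<alpha> :: real) (\<beta> :: real).
            degree P = n \<longrightarrow>
            (\<forall>z. poly P z = 0 \<longrightarrow> cmod z \<le> 1) \<longrightarrow>
            cmod z0 = 1 \<longrightarrow>
            0 < \<alpha> \<longrightarrow> \<alpha> < pi \<longrightarrow>
            (\<forall>z \<in> circle_arc z0 \<alpha>. poly P z \<noteq> 0) \<longrightarrow>
            0 < \<beta> \<longrightarrow> \<beta> < pi \<longrightarrow>
            increment_bounded P z0 \<alpha> \<beta> \<longrightarrow>
            Lambda P z0 \<le> tan (\<beta> / 2) / tan (\<alpha> / 2))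
       \<and> (\<forall>(c :: complex) (a :: nat \<Rightarrow> complex) (P :: complex poly) (\<alpha> :: real) (\<beta> :: real).
            P = smult c ([:0, 1:] * (\<Prod>k = 2..n. [:- a k, 1:])) \<longrightarrow>
            c \<noteq> 0 \<longrightarrow>
            (\<forall>k \<in> {2..n}. cmod (a k) = 1 \<and> a k \<noteq> 1) \<longrightarrow>
            0 < \<alpha> \<longrightarrow> \<alpha> < pi \<longrightarrow>
            (\<forall>k \<in> {2..n}. a k \<notin> circle_arc 1 \<alpha>) \<longrightarrow>
            \<beta> = \<alpha> \<longrightarrow>
            degree P = n \<and>
            (\<forall>z. poly P z = 0 \<longrightarrow> cmod z \<le> 1) \<and>
            (\<forall>z \<in> circle_arc 1 \<alpha>. poly P z \<noteq> 0) \<and>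
            increment_bounded P 1 \<alpha> \<beta> \<and>
            Lambda P 1 = tan (\<beta> / 2) / tan (\<alpha> / 2))"
proof (rule conjI; (intro allI impI)?)
  show "Lambda P z0 \<le> tan (\<beta> / 2) / tan (\<alpha> / 2)"
    if "degree P = n" "\<forall>z. poly P z = 0 \<longrightarrow> cmod z \<le> 1" "cmod z0 = 1"
      "0 < \<alpha>" "\<alpha> < pi" "\<forall>z \<in> circle_arc z0 \<alpha>. poly P z \<noteq> 0"
      "0 < \<beta>" "\<beta> < pi" "increment_bounded P z0 \<alpha> \<beta>"
    for P :: "complex poly" and z0 :: complex and \<alpha> \<beta> :: real
    using that assms by (intro Lambda_le_of_increment_bounded) auto
next
  fix c :: complex and a :: "nat \<Rightarrow> complex" and P :: "complex poly" and \<alpha> \<beta> :: real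
  assume P: "P = smult c ([:0, 1:] * (\<Prod>k = 2..n. [:- a k, 1:]))" and c: "c \<noteq> 0"
    and a: "\<forall>k \<in> {2..n}. cmod (a k) = 1 \<and> a k \<noteq> 1"
    and \<alpha>: "0 < \<alpha>" "\<alpha> < pi" and free: "\<forall>k \<in> {2..n}. a k \<notin> circle_arc 1 \<alpha>" and \<beta>: "\<beta> = \<alpha>"
  note extremal = extremal_polynomial[OF assms P c a \<alpha> free]
  have "tan (\<alpha> / 2) > 0" using \<alpha> by (intro tan_gt_zero) auto
  then show "degree P = n \<and> (\<forall>z. poly P z = 0 \<longrightarrow> cmod z \<le> 1) \<and>
      (\<forall>z \<in> circle_arc 1 \<alpha>. poly P z \<noteq> 0) \<and> increment_bounded P 1 \<alpha> \<beta> \<and>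
      Lambda P 1 = tan (\<beta> / 2) / tan (\<alpha> / 2)"
    using extremal by (simp add: \<beta>)
qed

end
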